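(* Let $\boldsymbol\alpha_i=(\alpha_{i,1},\ldots,\alpha_{i,k_i})$, $i=1,\ldots,n$, be spherical chains in $\mathbb H$ and let $m=\sum_{i=1}^n k_i$. The square confluent Vandermonde matrix $V_m^{\boldsymbol\ell}(\boldsymbol\alpha_1,\ldots,\boldsymbol\alpha_n)$ is invertible if and only if the leftmost elements $\alpha_{1,1},\alpha_{2,1},\ldots,\alpha_{n,1}$ are all distinct and no three of them belong to the same conjugacy class.
   Context: $\mathbb H$ is the skew field of (real) quaternions. $\alpha\sim\beta$ means $\alpha=h^{-1}\beta h$ for some nonzero $h\in\mathbb H$; equivalence classes are called conjugacy classes. A spherical chain (of length $k$) is a tuple $(\alpha_1,\ldots,\alpha_k)$ with $\alpha_1\sim\cdots\sim\alpha_k$ and $\alpha_{j+1}\neq\overline{\alpha}_j$ for $j=1,\ldots,k-1$. $\mathbb H[z]$ is the polynomial ring in a variable $z$ commuting with quaternion coefficients. For $f(z)=\sum_{j=0}^m z^jf_j$, the left evaluation is $f^{\boldsymbol{e_\ell}}(\alpha)=\sum\alpha^jf_j$, and $L_\alpha f$ is the unique polynomial with $f=f^{\boldsymbol{e_\ell}}(\alpha)+(z-\alpha)\cdot L_\alpha f$. Left divided differences: $[\alpha_1;f]_{\boldsymbol\ell}=f^{\boldsymbol{e_\ell}}(\alpha_1)$, $[\alpha_1,\ldots,\alpha_j;f]_{\boldsymbol\ell}=(L_{\alpha_{j-1}}\cdots L_{\alpha_1}f)^{\boldsymbol{e_\ell}}(\alpha_j)$ for $j\ge 2$. For a chain $\boldsymbol\alpha=(\alpha_1,\ldots,\alpha_k)$,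 $V_m^{\boldsymbol\ell}(\boldsymbol\alpha)$ is the $k\times m$ matrix with $(i,j)$ entry $[\alpha_1,\ldots,\alpha_i;z^{j-1}]_{\boldsymbol\ell}$; $V_m^{\boldsymbol\ell}(\boldsymbol\alpha_1,\ldots,\boldsymbol\alpha_n)$ is obtained by stacking the blocks $V_m^{\boldsymbol\ell}(\boldsymbol\alpha_1),\ldots,V_m^{\boldsymbol\ell}(\boldsymbol\alpha_n)$ vertically. *)

theory Defs
  imports "HOL-Library.Poly_Mapping" "Jordan_Normal_Form.Matrix"
begin

section \<open>The skew field of real quaternions\<close>

datatype quat = Quat (qRe: real) (qI: real) (qJ: real) (qK: real)

lemma quat_eq_iff: "x = y \<longleftrightarrow> qRe x = qRe y \<and> qI x = qI y \<and> qJ x = qJ y \<and> qK x = qK y"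
  by (cases x; cases y) simp

instantiation quat :: ring_1
begin

definition "0 = Quat 0 0 0 0"
definition "1 = Quat 1 0 0 0"
definition "x + y = Quat (qRe x + qRe y) (qI x + qI y) (qJ x + qJ y) (qK x + qK y)"
definition "x - y = Quat (qRe x - qRe y) (qI x - qI y) (qJ x - qJ y) (qK x - qK y)"
definition "- x = Quat (- qRe x) (- qI x) (- qJ x) (- qK x)"
definition "x * y = Quat
  (qRe x * qRe y - qI x * qI y - qJ x * qJ y - qK x * qK y)
  (qRe x * qI y + qI x * qRe y + qJ x * qK y - qK x * qJ y)
  (qRe x * qJ y - qI x * qK y + qJ x * qRe y + qK x * qI y)
  (qRe x * qK y + qI x * qJ y - qJ x * qI y + qK x * qRe y)"

instance
  by standard
    (simp_all add: zero_quat_def one_quat_def plus_quat_def minus_quat_def uminus_quat_def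
      times_quat_def algebra_simps)

end

definition qcnj :: "quat \<Rightarrow> quat" where
  "qcnj x = Quat (qRe x) (- qI x) (- qJ x) (- qK x)"

definition qnorm2 :: "quat \<Rightarrow> real" where
  "qnorm2 x = (qRe x)\<^sup>2 + (qI x)\<^sup>2 + (qJ x)\<^sup>2 + (qK x)\<^sup>2"

lemma qnorm2_eq_0_iff: "qnorm2 x = 0 \<longleftrightarrow> x = 0"
  by (auto simp: qnorm2_def zero_quat_def quat_eq_iff add_nonneg_eq_0_iff)

instantiation quat :: division_ring
begin

definition "inverse x = Quat (qRe x / qnorm2 x) (- qI x / qnorm2 x) (- qJ x / qnorm2 x) (- qK x / qnorm2 x)"
definition "x div y = x * inverse y" for x y :: quat

instance
proof
  fix x :: quat
  assume "x \<noteq> 0"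
  then have n: "qnorm2 x \<noteq> 0"
    by (simp add: qnorm2_eq_0_iff)
  have "(qRe x * qRe x + qI x * qI x + qJ x * qJ x + qK x * qK x) / qnorm2 x = 1"
    using n by (simp add: qnorm2_def power2_eq_square)
  then show "inverse x * x = 1" "x * inverse x = 1"
    by (simp_all add: inverse_quat_def times_quat_def one_quat_def mult.commute add_divide_distrib)
qed (simp_all add: divide_quat_def inverse_quat_def zero_quat_def)

end

definition qsim :: "quat \<Rightarrow> quat \<Rightarrow> bool" (infix \<open>\<sim>\<^sub>q\<close> 50) where
  "\<alpha> \<sim>\<^sub>q \<beta> \<longleftrightarrow> (\<exists>h. h \<noteq> 0 \<and> \<alpha> = inverse h * \<beta> * h)"

definition spherical_chain :: "quat list \<Rightarrow> bool" where
  "spherical_chain as \<longleftrightarrow> as \<noteq> [] \<and>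
    (\<forall>j. Suc j < length as \<longrightarrow> as ! j \<sim>\<^sub>q as ! Suc j \<and> as ! Suc j \<noteq> qcnj (as ! j))"


section \<open>Quaternion polynomials and left divided differences\<close>

text \<open>The type \<open>quat poly\<close> carries no multiplication, since \<open>poly\<close> requires commutative
  coefficients for it. The monoid algebra of \<^typ>\<open>nat\<close> over \<^typ>\<open>quat\<close> is the
  polynomial ring in a central variable: \<open>Poly_Mapping.single j c\<close> is the monomial
  with coefficient \<open>c\<close> and exponent \<open>j\<close>.\<close>

type_synonym qpoly = "nat \<Rightarrow>\<^sub>0 quat"

definition qconst :: "quat \<Rightarrow> qpoly" where
  "qconst c = Poly_Mapping.single 0 c"

definition Z :: qpoly where
  "Z = Poly_Mapping.single 1 1"

definition left_eval :: "qpoly \<Rightarrow> quat \<Rightarrow> quat" where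
  "left_eval f \<alpha> = (\<Sum>j\<in>Poly_Mapping.keys f. \<alpha> ^ j * Poly_Mapping.lookup f j)"

definition left_quot :: "quat \<Rightarrow> qpoly \<Rightarrow> qpoly" where
  "left_quot \<alpha> f = (THE g. f = qconst (left_eval f \<alpha>) + (Z - qconst \<alpha>) * g)"

lemma left_eval_superset:
  assumes "finite A" "Poly_Mapping.keys f \<subseteq> A"
  shows "left_eval f \<alpha> = (\<Sum>j\<in>A. \<alpha> ^ j * Poly_Mapping.lookup f j)"
  unfolding left_eval_def
  by (rule sum.mono_neutral_left) (use assms in \<open>auto simp: in_keys_iff\<close>)

lemma left_eval_add: "left_eval (f + g) \<alpha> = left_eval f \<alpha> + left_eval g \<alpha>"
proof -
  let ?A = "Poly_Mapping.keys f \<union> Poly_Mapping.keys g"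
  have "Poly_Mapping.keys (f + g) \<subseteq> ?A"
    by (rule Poly_Mapping.keys_add)
  then have "left_eval (f + g) \<alpha> = (\<Sum>j\<in>?A. \<alpha> ^ j * Poly_Mapping.lookup (f + g) j)"
    by (intro left_eval_superset) auto
  moreover have "left_eval f \<alpha> = (\<Sum>j\<in>?A. \<alpha> ^ j * Poly_Mapping.lookup f j)"
    "left_eval g \<alpha> = (\<Sum>j\<in>?A. \<alpha> ^ j * Poly_Mapping.lookup g j)"
    by (intro left_eval_superset; auto)+
  ultimately show ?thesis
    by (simp add: lookup_add algebra_simps sum.distrib)
qed

lemma left_eval_single: "left_eval (Poly_Mapping.single n c) \<alpha> = \<alpha> ^ n * c"
  by (subst left_eval_superset[of "{n}"]) (auto simp: in_keys_iff lookup_single when_def)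

lemma Z_power: "Z ^ n = Poly_Mapping.single n 1"
  by (induction n) (simp_all add: Z_def mult_single)

lemma qpoly_induct [case_names single sum]:
  fixes f :: qpoly
  assumes single: "\<And>n c. P (Poly_Mapping.single n c)"
    and sum: "\<And>f g. P f \<Longrightarrow> P g \<Longrightarrow> P (f + g)"
  shows "P f"
proof (induction f rule: update_induct)
  case const
  show ?case
    using single[of 0 0] by (simp flip: zero_poly_mapping_def)
next
  case (update f n c)
  have "Poly_Mapping.update n c f = f + Poly_Mapping.single n c"
    using update(1)
    by (intro poly_mapping_eqI)
      (auto simp: lookup_add lookup_update lookup_single when_def in_keys_iff)
  then show ?case
    using sum[OF update(3) single] by simp
qed

lemma left_quot_exists: "\<exists>g. f = qconst (left_eval f \<alpha>) + (Z - qconst \<alpha>) * g"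
proof (induction f rule: qpoly_induct)
  case (single n c)
  show ?case
  proof (induction n arbitrary: c)
    case 0
    show ?case
      by (rule exI[of _ 0]) (simp add: left_eval_single qconst_def)
  next
    case (Suc n)
    obtain g where g: "Poly_Mapping.single n c =
        qconst (\<alpha> ^ n * c) + (Z - qconst \<alpha>) * g"
      using Suc[of c] by (auto simp: left_eval_single)
    have "Poly_Mapping.single (Suc n) c = Poly_Mapping.single n c * Z"
      by (simp add: Z_def mult_single)
    also have "\<dots> = qconst (\<alpha> ^ n * c) * Z + (Z - qconst \<alpha>) * (g * Z)"
      by (simp add: g algebra_simps)
    also have "qconst (\<alpha> ^ n * c) * Z = Z * qconst (\<alpha> ^ n * c)"
      by (simp add: Z_def qconst_def mult_single)
    also have "\<dots> = qconst \<alpha> * qconst (\<alpha> ^ n * c) + (Z - qconst \<alpha>) * qconst (\<alpha> ^ n * c)"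
      by (simp add: algebra_simps)
    also have "qconst \<alpha> * qconst (\<alpha> ^ n * c) = qconst (\<alpha> ^ Suc n * c)"
      by (simp add: qconst_def mult_single mult.assoc)
    finally have "Poly_Mapping.single (Suc n) c = qconst (\<alpha> ^ Suc n * c) +
        (Z - qconst \<alpha>) * (qconst (\<alpha> ^ n * c) + g * Z)"
      by (simp add: algebra_simps)
    then show ?case
      unfolding left_eval_single by blast
  qed
next
  case (sum f1 f2)
  then obtain g1 g2 where g: "f1 = qconst (left_eval f1 \<alpha>) + (Z - qconst \<alpha>) * g1"
    "f2 = qconst (left_eval f2 \<alpha>) + (Z - qconst \<alpha>) * g2"
    by blast
  have "f1 + f2 = qconst (left_eval f1 \<alpha>) + (Z - qconst \<alpha>) * g1 +
      (qconst (left_eval f2 \<alpha>) + (Z - qconst \<alpha>) * g2)"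
    using g by simp
  also have "\<dots> = qconst (left_eval (f1 + f2) \<alpha>) + (Z - qconst \<alpha>) * (g1 + g2)"
    by (simp add: left_eval_add qconst_def single_add algebra_simps)
  finally show ?case
    by blast
qed

lemma left_quot_ex1: "\<exists>!g. f = qconst (left_eval f \<alpha>) + (Z - qconst \<alpha>) * g"
proof -
  have "Poly_Mapping.lookup (Z - qconst \<alpha>) 1 \<noteq> 0"
    by (simp add: Z_def qconst_def lookup_minus lookup_single)
  then have "Z - qconst \<alpha> \<noteq> 0"
    by (metis lookup_zero)
  then show ?thesis
    using left_quot_exists[of f \<alpha>] by (metis add_left_cancel mult_left_cancel)
qed

lemma left_quot: "f = qconst (left_eval f \<alpha>) + (Z - qconst \<alpha>) * left_quot \<alpha> f"
  unfolding left_quot_def by (rule theI'[OF left_quot_ex1])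

text \<open>Meaningful for nonempty lists only. \<open>fold\<close> applies \<open>left_quot\<close> for the head of the list
  first, so that it is the innermost of the operators.\<close>

definition left_divdiff :: "quat list \<Rightarrow> qpoly \<Rightarrow> quat" where
  "left_divdiff as f = left_eval (fold left_quot (butlast as) f) (last as)"


section \<open>Confluent Vandermonde matrices\<close>

text \<open>Matrix indices start at 0, so entry \<open>(i, j)\<close> uses the first \<open>i + 1\<close> chain
  elements and the \<open>j\<close>-th power of the variable.\<close>

definition chain_vandermonde :: "nat \<Rightarrow> quat list \<Rightarrow> quat mat" where
  "chain_vandermonde m as =
    mat (length as) m (\<lambda>(i, j). left_divdiff (take (Suc i) as) (Z ^ j))"

definition confluent_vandermonde :: "nat \<Rightarrow> quat list list \<Rightarrow> quat mat" where
  "confluent_vandermonde m ass =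
    foldr (\<lambda>as A. chain_vandermonde m as @\<^sub>r A) ass (0\<^sub>m 0 m)"

end

theory Submission
  imports Defs
begin

text \<open>If two leftmost elements coincide, or three are conjugate, the rows of powers of these elements
  are left dependent. Conversely, a kernel vector of the matrix is a polynomial \<open>f\<close> of degree less
  than \<open>m\<close> lying in every right ideal \<open>(z - a\<^sub>1) \<dots> (z - a\<^sub>k) H[z]\<close> given by a chain. Write
  \<open>f = (z - a) g\<close> with \<open>a\<close> the head of one chain. Commuting \<open>z - a\<close> past the factors of the other
  chains gives a system for \<open>g\<close> of total length \<open>m - 1\<close>: a head \<open>b\<close> becomes
  \<open>(b - a)\<^sup>-\<^sup>1 b (b - a)\<close>, which equals the conjugate of \<open>a\<close> when \<open>a\<close> and \<open>b\<close> are conjugate, so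
  the chain condition keeps the heads distinct. By induction \<open>g = 0\<close>.
  Over a division ring a square matrix with trivial kernel is invertible.\<close>

section \<open>Conjugacy and commuting linear factors\<close>

lemmas quat_defs = quat_eq_iff zero_quat_def one_quat_def plus_quat_def minus_quat_def
  uminus_quat_def times_quat_def qcnj_def

lemma qcnj_qcnj [simp]: "qcnj (qcnj x) = x"
  by (simp add: qcnj_def)

lemma qsim_iff_intertwine: "x \<sim>\<^sub>q y \<longleftrightarrow> (\<exists>h. h \<noteq> 0 \<and> h * x = y * h)"
proof -
  have "x = inverse h * y * h \<longleftrightarrow> h * x = y * h" if "h \<noteq> 0" for h
  proof
    assume "x = inverse h * y * h"
    then show "h * x = y * h" using that by (simp add: mult.assoc[symmetric])
  next
    assume "h * x = y * h"
    then have "inverse h * (h * x) = inverse h * (y * h)" by simp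
    then show "x = inverse h * y * h" using that by (simp add: mult.assoc[symmetric])
  qed
  then show ?thesis unfolding qsim_def by blast
qed

lemma qnorm2_mult: "qnorm2 (x * y) = qnorm2 x * qnorm2 y"
  by (simp add: qnorm2_def times_quat_def power2_eq_square algebra_simps)

lemma qRe_mult_commute: "qRe (x * y) = qRe (y * x)"
  by (simp add: times_quat_def)

text \<open>Conjugation preserves real part and norm. Conversely, \<open>y - qcnj x\<close>
  intertwines \<open>x\<close> and \<open>y\<close>, because both are roots of the same real
  quadratic; it vanishes only for \<open>x = qcnj y\<close>. In this form symmetry and transitivity
  are immediate.\<close>

lemma qsim_iff: "x \<sim>\<^sub>q y \<longleftrightarrow> qRe x = qRe y \<and> qnorm2 x = qnorm2 y"
proof
  assume "x \<sim>\<^sub>q y"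
  then obtain h where h: "h \<noteq> 0" "x = inverse h * y * h" by (auto simp: qsim_def)
  then have "h * x = y * h" by (simp add: mult.assoc[symmetric])
  then have "qnorm2 h * qnorm2 x = qnorm2 y * qnorm2 h" by (metis qnorm2_mult)
  then have "qnorm2 x = qnorm2 y" using h by (simp add: qnorm2_eq_0_iff)
  moreover have "qRe x = qRe (h * (inverse h * y))" unfolding h(2) by (rule qRe_mult_commute)
  ultimately show "qRe x = qRe y \<and> qnorm2 x = qnorm2 y"
    using h by (simp add: mult.assoc[symmetric])
next
  assume eq: "qRe x = qRe y \<and> qnorm2 x = qnorm2 y"
  show "x \<sim>\<^sub>q y"
  proof (cases "x = qcnj y")
    case False
    have "(y - qcnj x) * x = y * (y - qcnj x)"
      using eq by (auto simp: quat_defs qnorm2_def power2_eq_square algebra_simps)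
    moreover have "y - qcnj x \<noteq> 0" using False by auto
    ultimately show ?thesis unfolding qsim_iff_intertwine by blast
  next
    case True
    \<comment> \<open>A pure quaternion orthogonal to the vector part of \<open>y\<close>
      anticommutes with that part, so it intertwines \<open>qcnj y\<close> and
      \<open>y\<close>.\<close>
    define h where "h = (if qI y = 0 \<and> qJ y = 0 then Quat 0 1 0 0 else Quat 0 (- qJ y) (qI y) 0)"
    have "h \<noteq> 0" "h * x = y * h" by (auto simp: h_def True quat_defs)
    then show ?thesis unfolding qsim_iff_intertwine by blast
  qed
qed

text \<open>The quadratic has real, hence central, coefficients that depend only on the conjugacy
  class of \<open>x\<close>.\<close>

lemma quat_square: "x * x = Quat (2 * qRe x) 0 0 0 * x - Quat (qnorm2 x) 0 0 0"
  by (simp add: quat_defs qnorm2_def power2_eq_square)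

text \<open>For \<open>a \<noteq> b\<close>, this is the quaternion for which \<open>(z - a) (z - conj_diff a b)\<close> is the monic
  generator of \<open>(z - a) H[z] \<inter> (z - b) H[z]\<close>.\<close>

definition conj_diff :: "quat \<Rightarrow> quat \<Rightarrow> quat" where
  "conj_diff a b = inverse (b - a) * b * (b - a)"

lemma conj_diff_qsim: "a \<noteq> b \<Longrightarrow> conj_diff a b \<sim>\<^sub>q b"
  unfolding qsim_def conj_diff_def by (intro exI[of _ "b - a"]) simp

lemma diff_mult_conj_diff: "a \<noteq> b \<Longrightarrow> (b - a) * conj_diff a b = b * (b - a)"
  by (simp add: conj_diff_def mult.assoc[symmetric])

lemma conj_diff_unique:
  assumes "a \<noteq> b" "(b - a) * c = b * (b - a)"
  shows "conj_diff a b = c"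
proof -
  have "(b - a) * conj_diff a b = (b - a) * c"
    by (rule trans[OF diff_mult_conj_diff[OF assms(1)] assms(2)[symmetric]])
  moreover have "b - a \<noteq> 0" using assms(1) by simp
  ultimately show ?thesis using mult_left_cancel by blast
qed

text \<open>The central quadratic of the class, (z - a)(z - \<open>qcnj a\<close>), vanishes at
  \<open>b\<close> too, so it is the common multiple of z - a and z - b.\<close>

lemma conj_diff_same_class:
  assumes "a \<noteq> b" "a \<sim>\<^sub>q b"
  shows "conj_diff a b = qcnj a"
  by (rule conj_diff_unique[OF assms(1)])
    (use assms(2) in \<open>auto simp: qsim_iff quat_defs qnorm2_def power2_eq_square algebra_simps\<close>)

text \<open>Linear coefficients of (z - a)(z - \<open>conj_diff a b\<close>) = (z - b)(z -
  \<open>conj_diff b a\<close>). Both second roots arise by conjugation with \<open>b - a\<close>,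
  which fixes the difference \<open>b - a\<close>.\<close>

lemma conj_diff_add:
  assumes "a \<noteq> b"
  shows "a + conj_diff a b = b + conj_diff b a"
proof -
  define u where "u = b - a"
  have u: "u \<noteq> 0" "a - b = - u" using assms by (simp_all add: u_def)
  have "conj_diff b a = inverse u * a * u"
  proof (rule conj_diff_unique)
    show "(a - b) * (inverse u * a * u) = a * (a - b)"
      unfolding u(2) using u(1) by (simp add: mult.assoc[symmetric])
  qed (use assms in simp)
  moreover have "conj_diff a b = inverse u * b * u" by (simp only: conj_diff_def u_def)
  ultimately have "conj_diff a b - conj_diff b a = inverse u * (b - a) * u"
    by (simp only: left_diff_distrib right_diff_distrib)
  also have "\<dots> = b - a" using u(1) by (simp add: u_def[symmetric])
  finally show ?thesis by (simp add: algebra_simps)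
qed

text \<open>Constant coefficients of the same identity; they follow from the linear ones and the
  equation defining \<open>conj_diff a b\<close>.\<close>

lemma conj_diff_mult:
  assumes "a \<noteq> b"
  shows "a * conj_diff a b = b * conj_diff b a"
proof -
  have *: "b * conj_diff a b - a * conj_diff a b = b * (b - a)"
    using diff_mult_conj_diff[OF assms] by (simp add: algebra_simps)
  have "conj_diff b a = a + conj_diff a b - b" using conj_diff_add[OF assms] by (simp add: algebra_simps)
  then have "b * conj_diff b a = b * (a + conj_diff a b - b)" by simp
  also have "\<dots> = a * conj_diff a b + (b * conj_diff a b - a * conj_diff a b - b * (b - a))"
    by (simp add: algebra_simps)
  finally have "b * conj_diff b a = \<dots>" .
  then show ?thesis using * by simp
qed

text \<open>If \<open>(z - a) (z - d) = (z - b) (z - b')\<close> and likewise for \<open>c\<close>, then \<open>b\<close> and \<open>c\<close> are two roots of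
  a quadratic in the same class, which makes it central and its root \<open>a\<close> conjugate to \<open>b\<close>.\<close>

lemma conj_diff_inj:
  assumes "a \<noteq> b" "a \<noteq> c" "conj_diff a b = conj_diff a c" "b \<noteq> c"
  shows "a \<sim>\<^sub>q b"
proof -
  define d where "d = conj_diff a b"
  have db: "d \<sim>\<^sub>q b" and dc: "d \<sim>\<^sub>q c"
    using conj_diff_qsim assms unfolding d_def by metis+
  define t s where "t = Quat (2 * qRe d) 0 0 0" and "s = Quat (qnorm2 d) 0 0 0"
  have b: "(b - a) * d = b * (b - a)" and c: "(c - a) * d = c * (c - a)"
    using diff_mult_conj_diff assms unfolding d_def by metis+
  have bb: "b * b = t * b - s" and cc: "c * c = t * c - s"
    using quat_square[of b] quat_square[of c] db dc by (simp_all add: t_def s_def qsim_iff)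
  have tc: "t * x = x * t" for x by (simp add: t_def quat_defs)
  \<comment> \<open>Both \<open>b\<close> and \<open>c\<close> are roots of (z - a)(z - d) and of
    z^2 - t z + s. Combining the four equations leaves only this product, which is therefore
    0.\<close>
  have "(b - c) * (a + d - t) = (b - a) * d - b * (b - a) - ((c - a) * d - c * (c - a))
     + (b * b - (t * b - s)) - (c * c - (t * c - s))"
    by (simp add: algebra_simps tc)
  then have "a + d - t = 0" using b c bb cc assms(4) by simp
  then have "a = t - d" by (simp add: algebra_simps)
  then have "a = qcnj d" by (simp add: t_def quat_defs)
  then have "a \<sim>\<^sub>q d" by (simp add: qsim_iff qcnj_def qnorm2_def)
  then show ?thesis using db by (simp add: qsim_iff)
qed

text \<open>Equality would put \<open>a\<close> into the class of \<open>b\<close>, and then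
  \<open>conj_diff b a\<close> would be \<open>qcnj b\<close>. This lets a factor moved past z - b
  be moved past z - c as well.\<close>

lemma conj_diff_next_ne:
  assumes "a \<noteq> b" "b \<sim>\<^sub>q c" "c \<noteq> qcnj b"
  shows "conj_diff b a \<noteq> c"
  using assms conj_diff_qsim[of b a] conj_diff_same_class[of b a] by (auto simp: qsim_iff)

text \<open>Otherwise \<open>(z - a) \<chi> = (z - b) (z - c) (z - a'')\<close> for the central \<open>\<chi> = (z - b) (z - qcnj b)\<close>,
  and cancelling \<open>z - b\<close> makes \<open>c\<close> a root of \<open>(z - qcnj b) (z - a)\<close>, which forces \<open>a = b\<close>.\<close>

lemma conj_diff_chain_step:
  assumes "a \<noteq> b" "b \<sim>\<^sub>q c" "c \<noteq> qcnj b"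
  shows "conj_diff (conj_diff b a) c \<noteq> qcnj (conj_diff a b)"
proof
  define d where "d = conj_diff a b"
  define a' where "a' = conj_diff b a"
  assume eq: "conj_diff (conj_diff b a) c = qcnj (conj_diff a b)"
  have ne: "a' \<noteq> c" unfolding a'_def by (rule conj_diff_next_ne[OF assms])
  have db: "d \<sim>\<^sub>q b" unfolding d_def by (rule conj_diff_qsim[OF assms(1)])
  define s where "s = Quat (qnorm2 b) 0 0 0"
  have s: "x * s = s * x" for x by (simp add: s_def quat_defs)
  have dd: "d * qcnj d = s" using db by (auto simp: s_def quat_defs qsim_iff qnorm2_def power2_eq_square)
  have bb: "b * qcnj b = s" by (simp add: s_def quat_defs qnorm2_def power2_eq_square)
  have b0: "b \<noteq> 0"
  proof
    assume "b = 0"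
    then have "c = 0" using assms(2) qnorm2_eq_0_iff by (metis qsim_iff)
    then show False using assms(3) \<open>b = 0\<close> by (simp add: quat_defs)
  qed
  \<comment> \<open>Together, \<open>sum\<close> and \<open>prod\<close> express the cancelled
    identity (z - a')(z - \<open>qcnj d\<close>) = (z - \<open>qcnj b\<close>)(z - a).\<close>
  have sum: "a' + qcnj d = qcnj b + a"
  proof -
    have "a + d = b + a'" using conj_diff_add[OF assms(1)] unfolding d_def a'_def .
    moreover have "d + qcnj d = b + qcnj b" using db by (simp add: quat_defs qsim_iff)
    ultimately show ?thesis by (simp add: quat_defs)
  qed
  have prod: "a' * qcnj d = qcnj b * a"
  proof -
    have "b * (a' * qcnj d) = (b * a') * qcnj d" by (simp add: mult.assoc)
    also have "b * a' = a * d" using conj_diff_mult[OF assms(1)] unfolding d_def a'_def by simp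
    also have "a * d * qcnj d = s * a" by (simp add: mult.assoc dd s)
    also have "\<dots> = b * (qcnj b * a)" by (simp add: mult.assoc[symmetric] bb)
    finally show ?thesis using b0 by simp
  qed
  have "(c - a') * qcnj d = c * (c - a')"
    using diff_mult_conj_diff[OF ne] eq unfolding d_def a'_def by simp
  then have "c * (a' + qcnj d) - a' * qcnj d = c * c" by (simp add: algebra_simps)
  then have "c * qcnj b + c * a - qcnj b * a = c * c" unfolding sum prod by (simp add: algebra_simps)
  then have "(c - qcnj b) * a = c * (c - qcnj b)" by (simp add: algebra_simps)
  \<comment> \<open>The root \<open>c\<close> determines the second factor of (z -
    \<open>qcnj b\<close>)(z - a); as \<open>c\<close> lies in the class of \<open>b\<close>, that
    factor must be z - b.\<close>
  then have "conj_diff (qcnj b) c = a" using assms(3) by (intro conj_diff_unique) auto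
  moreover have "qRe (qcnj b) = qRe b" "qnorm2 (qcnj b) = qnorm2 b"
    by (simp_all add: qnorm2_def qcnj_def)
  then have "qcnj b \<sim>\<^sub>q c" using assms(2) by (simp add: qsim_iff)
  then have "conj_diff (qcnj b) c = b" using conj_diff_same_class[of "qcnj b" c] assms(3) by auto
  ultimately show False using assms(1) by simp
qed

section \<open>Linear factors and left roots of quaternion polynomials\<close>

abbreviation lin :: "quat \<Rightarrow> qpoly" where "lin a \<equiv> Z - qconst a"

lemma lin_nonzero: "lin a \<noteq> 0"
proof
  assume "lin a = 0"
  then have "Poly_Mapping.lookup (lin a) 1 = 0" by simp
  then show False by (simp add: Z_def qconst_def lookup_minus lookup_single)
qed

lemma lin_mult_lin:
  "lin a * lin b = Z * Z - qconst (a + b) * Z + qconst (a * b)"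
proof -
  have "Z * qconst b = qconst b * Z" by (simp add: Z_def qconst_def mult_single)
  moreover have "qconst (a * b) = qconst a * qconst b" "qconst (a + b) = qconst a + qconst b"
    by (simp_all add: qconst_def mult_single single_add)
  ultimately show ?thesis by (simp add: algebra_simps)
qed

lemma left_eval_minus: "left_eval (f - g) a = left_eval f a - left_eval g a"
  using left_eval_add[of "f - g" g a] by (simp add: algebra_simps)

text \<open>Left evaluation is not multiplicative: moving \<open>b - a\<close> to the left past
  powers of the evaluation point conjugates that point. On monomials this is
  \<open>pow\<close>.\<close>

lemma left_eval_lin_mult:
  assumes "a \<noteq> b"
  shows "left_eval (lin a * g) b = (b - a) * left_eval g (conj_diff a b)"
proof (induction g rule: qpoly_induct)
  case (single n c)
  have pow: "(b - a) * conj_diff a b ^ n = b ^ n * (b - a)"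
  proof (induction n)
    case (Suc n)
    have "(b - a) * conj_diff a b ^ Suc n = ((b - a) * conj_diff a b) * conj_diff a b ^ n"
      by (simp add: mult.assoc)
    then show ?case using Suc by (simp add: diff_mult_conj_diff[OF assms] mult.assoc)
  qed simp
  have "lin a * Poly_Mapping.single n c = Poly_Mapping.single (Suc n) c - Poly_Mapping.single n (a * c)"
    by (simp add: Z_def qconst_def mult_single left_diff_distrib)
  then have "left_eval (lin a * Poly_Mapping.single n c) b = b ^ n * (b - a) * c"
    by (simp only: left_eval_minus left_eval_single power_Suc2 right_diff_distrib left_diff_distrib mult.assoc)
  then show ?case by (simp add: left_eval_single mult.assoc[symmetric] pow)
qed (simp add: left_eval_add distrib_left)

lemma lin_dvd_iff: "(\<exists>g. f = lin a * g) \<longleftrightarrow> left_eval f a = 0"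
proof
  assume "\<exists>g. f = lin a * g"
  then obtain g where g: "f = lin a * g" ..
  have "left_eval (lin a * g) a = 0"
  proof (induction g rule: qpoly_induct)
    case (single n c)
    have "lin a * Poly_Mapping.single n c = Poly_Mapping.single (Suc n) c - Poly_Mapping.single n (a * c)"
      by (simp add: Z_def qconst_def mult_single left_diff_distrib)
    then show ?case
      by (simp add: left_eval_minus left_eval_single power_commutes mult.assoc[symmetric])
  qed (simp add: left_eval_add distrib_left)
  then show "left_eval f a = 0" using g by simp
next
  assume "left_eval f a = 0"
  then show "\<exists>g. f = lin a * g" using left_quot[of f a] by (auto simp: qconst_def)
qed

text \<open>The left root \<open>b\<close> of \<open>lin a * g\<close> yields the root
  \<open>conj_diff a b\<close> of \<open>g\<close>. Rewriting the resulting quadratic with z - b in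
  front and cancelling z - b gives \<open>h\<close>.\<close>

lemma lin_mult_eq_lin_multE:
  assumes "a \<noteq> b" "lin a * g = lin b * h"
  obtains k where "g = lin (conj_diff a b) * k" "h = lin (conj_diff b a) * k"
proof -
  have "left_eval (lin a * g) b = 0" using lin_dvd_iff assms(2) by blast
  then have "left_eval g (conj_diff a b) = 0" using assms(1) by (simp add: left_eval_lin_mult)
  then obtain k where k: "g = lin (conj_diff a b) * k" using lin_dvd_iff by blast
  have "lin b * h = lin a * lin (conj_diff a b) * k" using assms(2) k by (simp add: mult.assoc)
  also have "lin a * lin (conj_diff a b) = lin b * lin (conj_diff b a)"
    unfolding lin_mult_lin conj_diff_add[OF assms(1)] conj_diff_mult[OF assms(1)] ..
  finally have "lin b * h = lin b * (lin (conj_diff b a) * k)" by (simp add: mult.assoc)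
  then have "h = lin (conj_diff b a) * k" using lin_nonzero mult_left_cancel by blast
  with k show thesis by (rule that)
qed

section \<open>Right ideals given by chains\<close>

fun lin_factors :: "quat list \<Rightarrow> qpoly \<Rightarrow> bool" where
  "lin_factors [] f \<longleftrightarrow> True"
| "lin_factors (a # as) f \<longleftrightarrow> (\<exists>g. f = lin a * g \<and> lin_factors as g)"

lemma spherical_chain_Cons:
  "spherical_chain (a # as) \<longleftrightarrow>
    as = [] \<or> a \<sim>\<^sub>q hd as \<and> hd as \<noteq> qcnj a \<and> spherical_chain as"
proof (cases as)
  case (Cons b bs)
  then show ?thesis
    unfolding spherical_chain_def by (auto simp: nth_Cons split: nat.splits)
qed (simp add: spherical_chain_def)

text \<open>Passing z - a to the right of z - b turns \<open>b\<close> into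
  \<open>conj_diff a b\<close> and \<open>a\<close> into \<open>conj_diff b a\<close>; the latter
  then has to pass the tail, so the induction generalizes over \<open>a\<close>.
  \<open>conj_diff_chain_step\<close> preserves the chain condition.\<close>

lemma lin_factors_cancel:
  assumes "spherical_chain bs" "a \<noteq> hd bs" "lin_factors bs (lin a * g)"
  shows "\<exists>cs. length cs = length bs \<and> spherical_chain cs \<and> hd cs = conj_diff a (hd bs) \<and>
    lin_factors cs g"
  using assms
proof (induction bs arbitrary: a g)
  case Nil
  then show ?case by (simp add: spherical_chain_def)
next
  case (Cons b bs)
  from Cons.prems have ab: "a \<noteq> b" by simp
  from Cons.prems obtain h where h: "lin a * g = lin b * h" "lin_factors bs h" by auto
  from lin_mult_eq_lin_multE[OF ab h(1)] obtain k
    where k: "g = lin (conj_diff a b) * k" "h = lin (conj_diff b a) * k" .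
  show ?case
  proof (cases "bs = []")
    case True
    then show ?thesis using k by (intro exI[of _ "[conj_diff a b]"]) (simp add: spherical_chain_def)
  next
    case False
    then have bs: "b \<sim>\<^sub>q hd bs" "hd bs \<noteq> qcnj b" "spherical_chain bs"
      using Cons.prems(1) by (auto simp: spherical_chain_Cons)
    note ne = conj_diff_next_ne[OF ab bs(1,2)]
    obtain cs where cs: "length cs = length bs" "spherical_chain cs"
        "hd cs = conj_diff (conj_diff b a) (hd bs)" "lin_factors cs k"
      using Cons.IH[OF bs(3) ne] h(2) k(2) by auto
    have "conj_diff a b \<sim>\<^sub>q hd cs"
      using conj_diff_qsim[OF ab] conj_diff_qsim[OF ne] bs(1) cs(3) by (simp add: qsim_iff)
    then have "spherical_chain (conj_diff a b # cs)"
      using cs conj_diff_chain_step[OF ab bs(1,2)] by (simp add: spherical_chain_Cons)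
    then show ?thesis using cs k by (intro exI[of _ "conj_diff a b # cs"]) auto
  qed
qed

text \<open>The leading coefficient of \<open>g\<close>, in degree \<open>N\<close>, reappears in
  degree \<open>Suc N\<close> of the product.\<close>

lemma lookup_eq_0_of_lin_mult:
  assumes "\<And>j. j \<ge> Suc m \<Longrightarrow> Poly_Mapping.lookup (lin a * g) j = 0" "j \<ge> m"
  shows "Poly_Mapping.lookup g j = 0"
proof (rule ccontr)
  assume nz: "Poly_Mapping.lookup g j \<noteq> 0"
  have rec: "Poly_Mapping.lookup (lin a * g) (Suc i) =
      Poly_Mapping.lookup g i - a * Poly_Mapping.lookup g (Suc i)" for i
  proof (induction g rule: qpoly_induct)
    case (single n c)
    have "lin a * Poly_Mapping.single n c = Poly_Mapping.single (Suc n) c - Poly_Mapping.single n (a * c)"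
      by (simp add: Z_def qconst_def mult_single left_diff_distrib)
    then show ?case by (simp add: lookup_minus lookup_single when_def)
  qed (simp add: lookup_add distrib_left)
  define N where "N = Max (Poly_Mapping.keys g)"
  have "N \<in> Poly_Mapping.keys g" unfolding N_def using nz by (intro Max_in) (auto simp: in_keys_iff)
  moreover have "j \<le> N" unfolding N_def using nz by (intro Max_ge) (auto simp: in_keys_iff)
  moreover have "Suc N \<notin> Poly_Mapping.keys g"
    unfolding N_def by (metis Max_ge finite_keys not_less_eq_eq order_refl)
  ultimately show False using rec[of N] assms(1)[of "Suc N"] assms(2) by (simp add: in_keys_iff)
qed

text \<open>Induction on the total length: removing the head \<open>a\<close> of one chain lowers
  both the length and the degree bound by one. The other chains are moved past z - a, and by
  \<open>sim\<close> each head stays in its class.\<close>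

lemma lin_factors_system_eq_0:
  fixes \<alpha> :: "'i \<Rightarrow> quat list"
  assumes "finite I" "\<And>i. i \<in> I \<Longrightarrow> spherical_chain (\<alpha> i)"
    and "inj_on (\<lambda>i. hd (\<alpha> i)) I"
    and "\<And>i j k. i \<in> I \<Longrightarrow> j \<in> I \<Longrightarrow> k \<in> I \<Longrightarrow> i \<noteq> j \<Longrightarrow> i \<noteq> k \<Longrightarrow> j \<noteq> k \<Longrightarrow>
      hd (\<alpha> i) \<sim>\<^sub>q hd (\<alpha> j) \<Longrightarrow> \<not> hd (\<alpha> i) \<sim>\<^sub>q hd (\<alpha> k)"
    and "\<And>i. i \<in> I \<Longrightarrow> lin_factors (\<alpha> i) f"
    and "\<And>j. j \<ge> (\<Sum>i\<in>I. length (\<alpha> i)) \<Longrightarrow> Poly_Mapping.lookup f j = 0"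
  shows "f = 0"
  using assms
proof (induction "\<Sum>i\<in>I. length (\<alpha> i)" arbitrary: I \<alpha> f)
  case 0
  then show ?case by (auto intro: poly_mapping_eqI)
next
  case (Suc m)
  from Suc.hyps(2) obtain p where p: "p \<in> I" "\<alpha> p \<noteq> []"
    by (metis list.size(3) nat.distinct(1) sum.neutral)
  then obtain a as where aas: "\<alpha> p = a # as" by (cases "\<alpha> p") auto
  from Suc.prems(5)[OF p(1)] aas obtain g where g: "f = lin a * g" "lin_factors as g" by auto
  have ne: "a \<noteq> hd (\<alpha> i)" if "i \<in> I" "i \<noteq> p" for i
    using inj_onD[OF Suc.prems(3), of p i] that p(1) aas by auto
  have "\<forall>i. \<exists>cs. i \<in> I - {p} \<longrightarrow> length cs = length (\<alpha> i) \<and> spherical_chain cs \<and>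
      hd cs = conj_diff a (hd (\<alpha> i)) \<and> lin_factors cs g"
    using lin_factors_cancel Suc.prems(2,5) ne g by blast
  then obtain \<beta> where \<beta>: "i \<in> I - {p} \<Longrightarrow> length (\<beta> i) = length (\<alpha> i) \<and> spherical_chain (\<beta> i) \<and>
      hd (\<beta> i) = conj_diff a (hd (\<alpha> i)) \<and> lin_factors (\<beta> i) g" for i
    by metis
  define \<gamma> where "\<gamma> = \<beta>(p := as)"
  \<comment> \<open>A chain of length one is used up; its index is dropped because spherical chains
    are nonempty.\<close>
  define J where "J = (if as = [] then I - {p} else I)"
  have J: "J \<subseteq> I" "finite J" using Suc.prems(1) by (auto simp: J_def)
  have pJ: "spherical_chain as \<and> a \<sim>\<^sub>q hd as \<and> hd as \<noteq> qcnj a" if "p \<in> J"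
    using that Suc.prems(2)[OF p(1)] aas by (auto simp: J_def spherical_chain_Cons split: if_splits)
  have sim: "hd (\<gamma> i) \<sim>\<^sub>q hd (\<alpha> i)" if "i \<in> J" for i
  proof (cases "i = p")
    case True
    then show ?thesis using pJ that aas by (simp add: \<gamma>_def qsim_iff)
  next
    case False
    then show ?thesis using \<beta>[of i] that J conj_diff_qsim[OF ne[of i]] by (auto simp: \<gamma>_def)
  qed
  have len: "m = (\<Sum>i\<in>J. length (\<gamma> i))"
  proof -
    have "(\<Sum>i\<in>J. length (\<gamma> i)) = (\<Sum>i\<in>I. length (\<gamma> i))"
      using Suc.prems(1) by (intro sum.mono_neutral_left) (auto simp: J_def \<gamma>_def split: if_splits)
    moreover have "(\<Sum>i\<in>I. length (\<gamma> i)) = length as + (\<Sum>i\<in>I - {p}. length (\<gamma> i))"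
      using Suc.prems(1) p(1) by (simp add: sum.remove \<gamma>_def)
    moreover have "(\<Sum>i\<in>I - {p}. length (\<gamma> i)) = (\<Sum>i\<in>I - {p}. length (\<alpha> i))"
      using \<beta> by (intro sum.cong) (auto simp: \<gamma>_def)
    moreover have "Suc m = Suc (length as) + (\<Sum>i\<in>I - {p}. length (\<alpha> i))"
      using Suc.hyps(2) Suc.prems(1) p(1) aas by (simp add: sum.remove)
    ultimately show ?thesis by simp
  qed
  \<comment> \<open>Any other head in the class of \<open>a\<close> has moved to
    \<open>qcnj a\<close>, which the chain condition on \<open>a # as\<close> keeps away from
    \<open>hd as\<close>.\<close>
  have no_coll: "hd (\<gamma> j) \<noteq> hd as" if "j \<in> J" "j \<noteq> p" "p \<in> J" for j
  proof
    assume eq: "hd (\<gamma> j) = hd as"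
    then have "a \<sim>\<^sub>q hd (\<alpha> j)" using sim[OF that(1)] pJ[OF that(3)] by (simp add: qsim_iff)
    then have "hd (\<gamma> j) = qcnj a"
      using \<beta>[of j] that J conj_diff_same_class ne by (auto simp: \<gamma>_def)
    then show False using eq pJ[OF that(3)] by simp
  qed
  have "g = 0"
  proof (rule Suc.hyps(1)[OF len J(2)])
    show "spherical_chain (\<gamma> i)" if "i \<in> J" for i
      using that J pJ \<beta>[of i] by (auto simp: \<gamma>_def)
    show "inj_on (\<lambda>i. hd (\<gamma> i)) J"
    proof (rule inj_onI, rule ccontr)
      fix i j assume ij: "i \<in> J" "j \<in> J" "hd (\<gamma> i) = hd (\<gamma> j)" "i \<noteq> j"
      have "i \<noteq> p" "j \<noteq> p" using no_coll[of i] no_coll[of j] ij by (auto simp: \<gamma>_def)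
      then have *: "conj_diff a (hd (\<alpha> i)) = conj_diff a (hd (\<alpha> j))"
        using \<beta>[of i, THEN conjunct2] \<beta>[of j, THEN conjunct2] ij J by (metis (no_types, lifting) DiffI \<gamma>_def fun_upd_other singletonD subsetD)
      have "hd (\<alpha> i) \<noteq> hd (\<alpha> j)"
        using ij J Suc.prems(3) by (meson inj_onD subsetD)
      \<comment> \<open>By \<open>conj_diff_inj\<close>, two moved heads coincide only if the heads
        at \<open>p\<close>, \<open>i\<close> and \<open>j\<close> are three conjugate ones.\<close>
      then have "a \<sim>\<^sub>q hd (\<alpha> i)"
        using conj_diff_inj[OF ne ne *] ij J \<open>i \<noteq> p\<close> \<open>j \<noteq> p\<close> by auto
      moreover have "hd (\<alpha> i) \<sim>\<^sub>q hd (\<alpha> j)"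
        using sim[OF ij(1)] sim[OF ij(2)] ij(3) by (simp add: qsim_iff)
      ultimately show False
        using Suc.prems(4)[of p i j] ij J p aas \<open>i \<noteq> p\<close> \<open>j \<noteq> p\<close> by (auto simp: qsim_iff)
    qed
    show "\<not> hd (\<gamma> i) \<sim>\<^sub>q hd (\<gamma> k)"
      if "i \<in> J" "j \<in> J" "k \<in> J" "i \<noteq> j" "i \<noteq> k" "j \<noteq> k" "hd (\<gamma> i) \<sim>\<^sub>q hd (\<gamma> j)" for i j k
      using Suc.prems(4)[of i j k] that J sim[of i] sim[of j] sim[of k] by (auto simp: qsim_iff)
    show "lin_factors (\<gamma> i) g" if "i \<in> J" for i
      using that J g(2) \<beta>[of i] by (auto simp: \<gamma>_def)
    show "Poly_Mapping.lookup g j = 0" if "j \<ge> (\<Sum>i\<in>J. length (\<gamma> i))" for j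
      using lookup_eq_0_of_lin_mult[of m a g j] Suc.prems(6) Suc.hyps(2) g(1) len that by auto
  qed
  then show ?case using g(1) by simp
qed

section \<open>Divided differences\<close>

lemma left_quot_unique: "f = qconst (left_eval f a) + lin a * g \<Longrightarrow> left_quot a f = g"
  using left_quot[of f a] left_quot_ex1[of f a] by blast

lemma left_quot_add: "left_quot a (f + g) = left_quot a f + left_quot a g"
proof (rule left_quot_unique)
  have "qconst (left_eval (f + g) a) = qconst (left_eval f a) + qconst (left_eval g a)"
    by (simp add: left_eval_add qconst_def single_add)
  then show "f + g = qconst (left_eval (f + g) a) + lin a * (left_quot a f + left_quot a g)"
    using left_quot[of f a] left_quot[of g a] by (metis (no_types, lifting) add.assoc add.left_commute distrib_left)
qed

text \<open>Coefficients stand to the right of the powers, so left evaluation is right linear.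
  Quotients and divided differences inherit this, which makes the matrix times a coefficient column
  a column of divided differences.\<close>

lemma left_eval_mult_qconst: "left_eval (f * qconst c) a = left_eval f a * c"
proof (induction f rule: qpoly_induct)
  case (single n d)
  then show ?case by (simp add: qconst_def mult_single left_eval_single mult.assoc)
qed (simp add: left_eval_add distrib_right)

lemma left_quot_mult_qconst: "left_quot a (f * qconst c) = left_quot a f * qconst c"
proof (rule left_quot_unique)
  have "qconst (left_eval (f * qconst c) a) = qconst (left_eval f a) * qconst c"
    by (simp add: left_eval_mult_qconst) (simp add: qconst_def mult_single)
  then show "f * qconst c = qconst (left_eval (f * qconst c) a) + lin a * (left_quot a f * qconst c)"
    using left_quot[of f a] by (metis distrib_right mult.assoc)
qed

lemma left_divdiff_Cons_Cons: "left_divdiff (a # b # bs) f = left_divdiff (b # bs) (left_quot a f)"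
  by (simp add: left_divdiff_def)

lemma left_divdiff_add: "left_divdiff as (f + g) = left_divdiff as f + left_divdiff as g"
proof -
  have "fold left_quot bs (f + g) = fold left_quot bs f + fold left_quot bs g" for bs
    by (induction bs arbitrary: f g) (simp_all add: left_quot_add)
  then show ?thesis by (simp add: left_divdiff_def left_eval_add)
qed

lemma left_divdiff_mult_qconst: "left_divdiff as (f * qconst c) = left_divdiff as f * c"
proof -
  have "fold left_quot bs (f * qconst c) = fold left_quot bs f * qconst c" for bs
    by (induction bs arbitrary: f) (simp_all add: left_quot_mult_qconst)
  then show ?thesis by (simp add: left_divdiff_def left_eval_mult_qconst)
qed

lemma left_divdiff_sum:
  assumes "finite A"
  shows "left_divdiff as (\<Sum>j\<in>A. f j * qconst (c j)) = (\<Sum>j\<in>A. left_divdiff as (f j) * c j)"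
  using assms
proof (induction A rule: finite_induct)
  case empty
  \<comment> \<open>Writing the zero polynomial as a product lets right homogeneity give its
    value.\<close>
  have "left_divdiff as (0 * qconst 0) = 0" unfolding left_divdiff_mult_qconst by simp
  then show ?case by simp
qed (simp add: left_divdiff_add left_divdiff_mult_qconst)

text \<open>The first divided difference is the remainder on division by z - a. When it is 0,
  \<open>left_quot a f\<close> is the cofactor, and the later differences are those of the cofactor
  along the tail.\<close>

lemma lin_factors_of_left_divdiff:
  assumes "\<And>r. r < length as \<Longrightarrow> left_divdiff (take (Suc r) as) f = 0"
  shows "lin_factors as f"
  using assms
proof (induction as arbitrary: f)
  case (Cons a as)
  have "left_eval f a = 0" using Cons.prems[of 0] by (simp add: left_divdiff_def)
  then have f: "f = lin a * left_quot a f" using left_quot[of f a] by (simp add: qconst_def)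
  have "left_divdiff (take (Suc r) as) (left_quot a f) = 0" if "r < length as" for r
    using Cons.prems[of "Suc r"] that by (cases as) (simp_all add: left_divdiff_Cons_Cons)
  then have "lin_factors as (left_quot a f)" by (rule Cons.IH)
  with f show ?case by auto
qed simp

section \<open>Linear systems over a division ring\<close>

text \<open>Gaussian elimination, which works over a division ring because the unknowns stand on the
  right and rows are scaled from the left.\<close>

lemma wide_system_nontrivial_solution:
  fixes A :: "'r \<Rightarrow> 'c \<Rightarrow> 'a :: division_ring"
  assumes "finite R" "finite C" "card R < card C"
  shows "\<exists>x. (\<exists>j\<in>C. x j \<noteq> 0) \<and> (\<forall>i\<in>R. (\<Sum>j\<in>C. A i j * x j) = 0)"
  using assms
proof (induction R arbitrary: A C rule: finite_induct)
  case empty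
  then have "C \<noteq> {}" by auto
  then show ?case by (intro exI[of _ "\<lambda>_. 1"]) auto
next
  case (insert r R)
  show ?case
  proof (cases "\<forall>j\<in>C. A r j = 0")
    case True
    have "card R < card C" using insert by simp
    then obtain x where "\<exists>j\<in>C. x j \<noteq> 0" "\<forall>i\<in>R. (\<Sum>j\<in>C. A i j * x j) = 0"
      using insert.IH[OF insert.prems(1)] by blast
    with True show ?thesis by (intro exI[of _ x]) simp
  next
    case False
    then obtain q where q: "q \<in> C" "A r q \<noteq> 0" by blast
    define C' where "C' = C - {q}"
    have C': "C = insert q C'" "q \<notin> C'" "finite C'" using q insert.prems by (auto simp: C'_def)
    then have "card R < card C'" using insert by simp
    then obtain x where x: "\<exists>j\<in>C'. x j \<noteq> 0"
        "\<And>i. i \<in> R \<Longrightarrow> (\<Sum>j\<in>C'. (A i j - A i q * (inverse (A r q) * A r j)) * x j) = 0"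
      using insert.IH[OF C'(3), of "\<lambda>i j. A i j - A i q * (inverse (A r q) * A r j)"] by blast
    define s where "s = (\<Sum>j\<in>C'. A r j * x j)"
    \<comment> \<open>The entry at the pivot column \<open>q\<close> is chosen to solve equation
      \<open>r\<close>.\<close>
    define y where "y = x(q := - (inverse (A r q) * s))"
    have y: "(\<Sum>j\<in>C. A i j * y j) = (\<Sum>j\<in>C'. A i j * x j) - A i q * (inverse (A r q) * s)" for i
    proof -
      have "(\<Sum>j\<in>C'. A i j * y j) = (\<Sum>j\<in>C'. A i j * x j)"
        using C' by (intro sum.cong) (auto simp: y_def)
      then show ?thesis using C' by (simp add: y_def)
    qed
    have "(\<Sum>j\<in>C. A r j * y j) = 0"
      unfolding y using q by (simp add: mult.assoc[symmetric] s_def)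
    moreover have "(\<Sum>j\<in>C. A i j * y j) = 0" if "i \<in> R" for i
    proof -
      have "A i q * (inverse (A r q) * s) = (\<Sum>j\<in>C'. A i q * (inverse (A r q) * A r j) * x j)"
        by (simp add: s_def sum_distrib_left mult.assoc)
      then show ?thesis
        unfolding y using x(2)[OF that] by (simp add: left_diff_distrib sum_subtractf)
    qed
    moreover have "\<exists>j\<in>C. y j \<noteq> 0" using x(1) C' by (auto simp: y_def)
    ultimately show ?thesis by (intro exI[of _ y]) simp
  qed
qed

text \<open>To solve A x = b, append \<open>b\<close> as an extra column: a nontrivial solution of
  the wider system has nonzero last entry, since the kernel is trivial, and can be normalised from
  the right. This gives a right inverse.\<close>

lemma invertible_mat_of_trivial_kernel:
  fixes A :: "'a :: division_ring mat"
  assumes A: "A \<in> carrier_mat m m"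
    and ker: "\<And>x. (\<And>i. i < m \<Longrightarrow> (\<Sum>j<m. A $$ (i, j) * x j) = 0) \<Longrightarrow> \<forall>j<m. x j = 0"
  shows "invertible_mat A"
proof -
  have solve: "\<exists>x. \<forall>i<m. (\<Sum>j<m. A $$ (i, j) * x j) = b i" for b
  proof -
    obtain x where x: "\<exists>j\<in>{..<Suc m}. x j \<noteq> 0"
      "\<forall>i\<in>{..<m}. (\<Sum>j\<in>{..<Suc m}. (if j = m then b i else A $$ (i, j)) * x j) = 0"
      using wide_system_nontrivial_solution[of "{..<m}" "{..<Suc m}"
          "\<lambda>i j. if j = m then b i else A $$ (i, j)"] by auto
    have eq: "(\<Sum>j<m. A $$ (i, j) * x j) + b i * x m = 0" if "i < m" for i
    proof -
      have "(\<Sum>j<m. A $$ (i, j) * x j) = (\<Sum>j<m. (if j = m then b i else A $$ (i, j)) * x j)"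
        by (intro sum.cong) auto
      then show ?thesis using x(2) that by simp
    qed
    have "x m \<noteq> 0"
    proof
      assume 0: "x m = 0"
      then have "\<forall>j<m. x j = 0" using ker[of x] eq by simp
      then show False using x(1) 0 by (auto simp: less_Suc_eq)
    qed
    then have "(\<Sum>j<m. A $$ (i, j) * (- x j * inverse (x m))) = b i" if "i < m" for i
    proof -
      have "(\<Sum>j<m. A $$ (i, j) * x j) = - b i * x m" using eq[OF that] by (simp add: eq_neg_iff_add_eq_0)
      then have *: "(\<Sum>j<m. A $$ (i, j) * x j) * inverse (x m) = - b i"
        using \<open>x m \<noteq> 0\<close> by (simp add: mult.assoc)
      have "(\<Sum>j<m. A $$ (i, j) * (- x j * inverse (x m))) =
          - ((\<Sum>j<m. A $$ (i, j) * x j) * inverse (x m))"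
        by (simp add: sum_distrib_right mult.assoc sum_negf)
      then show ?thesis unfolding * minus_minus .
    qed
    then show ?thesis by (intro exI[of _ "\<lambda>j. - x j * inverse (x m)"]) blast
  qed
  have "\<exists>X. \<forall>k. \<forall>i<m. (\<Sum>j<m. A $$ (i, j) * X k j) = (if i = k then 1 else 0)"
    by (rule choice, rule allI, rule solve)
  then obtain X where X: "\<And>k i. i < m \<Longrightarrow> (\<Sum>j<m. A $$ (i, j) * X k j) = (if i = k then 1 else 0)"
    by blast
  define B where "B = mat m m (\<lambda>(j, k). X k j)"
  have B: "B \<in> carrier_mat m m" by (simp add: B_def)
  have AB: "A * B = 1\<^sub>m m"
    using A X by (intro eq_matI) (auto simp: B_def scalar_prod_def lessThan_atLeast0)
  have "B * A = 1\<^sub>m m"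
  proof (rule eq_matI)
    fix i k assume ik: "i < dim_row (1\<^sub>m m :: 'a mat)" "k < dim_col (1\<^sub>m m :: 'a mat)"
    \<comment> \<open>The right inverse is two-sided: A (B A - 1) = 0, so the columns of
      \<open>D\<close> lie in the trivial kernel.\<close>
    define D where "D = B * A - 1\<^sub>m m"
    have D: "D \<in> carrier_mat m m" using A B by (intro carrier_matI) (simp_all add: D_def)
    have "A * D = A * (B * A) - A * 1\<^sub>m m" unfolding D_def
      by (rule mult_minus_distrib_mat) (use A B in auto)
    also have "A * (B * A) = A" using assoc_mult_mat[OF A B A] AB A by simp
    finally have AD: "A * D = 0\<^sub>m m m" using A by simp
    have "\<forall>j<m. D $$ (j, k) = 0"
    proof (rule ker)
      fix i assume "i < m"
      then have "(A * D) $$ (i, k) = (\<Sum>j<m. A $$ (i, j) * D $$ (j, k))"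
        using A D ik by (simp add: scalar_prod_def lessThan_atLeast0)
      then show "(\<Sum>j<m. A $$ (i, j) * D $$ (j, k)) = 0" using AD ik \<open>i < m\<close> by simp
    qed
    then show "(B * A) $$ (i, k) = 1\<^sub>m m $$ (i, k)" using ik A B by (simp add: D_def)
  qed (use A B in auto)
  then show ?thesis using A B AB by (auto simp: invertible_mat_def inverts_mat_def)
qed

lemma invertible_mat_left_null:
  fixes A :: "'a :: division_ring mat"
  assumes "A \<in> carrier_mat m m" "invertible_mat A"
    and "\<And>j. j < m \<Longrightarrow> (\<Sum>i<m. u i * A $$ (i, j)) = 0" "k < m"
  shows "u k = 0"
proof -
  obtain B where B: "A * B = 1\<^sub>m m" "B * A = 1\<^sub>m (dim_row B)"
    using assms(1,2) by (auto simp: invertible_mat_def inverts_mat_def)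
  \<comment> \<open>Invertibility does not state the shape of \<open>B\<close>; it is read off from
    the two products.\<close>
  have "dim_col B = m" using B(1) by (metis index_mult_mat(3) index_one_mat(3))
  moreover have "dim_row B = m"
    using B(2) assms(1) by (metis carrier_matD(2) index_mult_mat(3) index_one_mat(3))
  ultimately have Bc: "B \<in> carrier_mat m m" by auto
  define U where "U = mat 1 m (\<lambda>(_, i). u i)"
  have U: "U \<in> carrier_mat 1 m" by (simp add: U_def)
  have UA: "U * A = 0\<^sub>m 1 m"
    using assms(1,3) by (intro eq_matI) (auto simp: U_def scalar_prod_def lessThan_atLeast0)
  have "U = U * (A * B)" using B U by simp
  also have "\<dots> = U * A * B" using assoc_mult_mat[OF U assms(1) Bc] by simp
  also have "\<dots> = 0\<^sub>m 1 m" using UA Bc by simp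
  finally have "U $$ (0, k) = 0" using assms(4) by simp
  then show ?thesis using assms(4) by (simp add: U_def)
qed

section \<open>Confluent Vandermonde matrices\<close>

lemma confluent_vandermonde_carrier:
  "confluent_vandermonde m ass \<in> carrier_mat (sum_list (map length ass)) m"
  by (induction ass)
    (auto simp: confluent_vandermonde_def chain_vandermonde_def intro!: carrier_append_rows)

lemma sum_list_take_length_less:
  assumes "i < length ass" "r < length (ass ! i)"
  shows "sum_list (map length (take i ass)) + r < sum_list (map length ass)"
  using assms
proof (induction ass arbitrary: i)
  case (Cons as ass)
  then show ?case by (cases i) auto
qed simp

lemma confluent_vandermonde_index:
  assumes "i < length ass" "r < length (ass ! i)" "j < m"
  shows "confluent_vandermonde m ass $$ (sum_list (map length (take i ass)) + r, j) =
    left_divdiff (take (Suc r) (ass ! i)) (Z ^ j)"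
  using assms
proof (induction ass arbitrary: i)
  case (Cons as ass)
  have step: "confluent_vandermonde m (as # ass) =
      chain_vandermonde m as @\<^sub>r confluent_vandermonde m ass"
    by (simp add: confluent_vandermonde_def)
  have dims: "dim_row (confluent_vandermonde m ass) = sum_list (map length ass)"
    "dim_col (confluent_vandermonde m ass) = m"
    "dim_row (chain_vandermonde m as) = length as" "dim_col (chain_vandermonde m as) = m"
    using confluent_vandermonde_carrier[of m ass] by (auto simp: chain_vandermonde_def)
  show ?case
  proof (cases i)
    case 0
    then show ?thesis using Cons.prems unfolding step append_rows_def
      by (subst index_mat_four_block) (auto simp: dims, simp add: chain_vandermonde_def)
  next
    case (Suc k)
    then show ?thesis
      using Cons.prems Cons.IH[of k] sum_list_take_length_less[of k ass r]
      unfolding step append_rows_def by (subst index_mat_four_block) (auto simp: dims)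
  qed
qed simp

text \<open>Nonempty blocks start at different rows, so the coefficients of a dependence between
  their first rows do not overlap.\<close>

lemma sum_list_take_strict_mono:
  assumes "i < k" "k \<le> length ass" "\<And>as. as \<in> set ass \<Longrightarrow> as \<noteq> []"
  shows "sum_list (map length (take i ass)) < sum_list (map length (take k ass))"
proof -
  have "sum_list (map length (take i (take k ass))) + 0 < sum_list (map length (take k ass))"
    by (rule sum_list_take_length_less) (use assms in auto)
  then show ?thesis using assms(1) by (simp add: min_def)
qed

text \<open>Powers in one conjugacy class satisfy \<open>a\<^sup>j = p\<^sub>j + q\<^sub>j a\<close> with common real \<open>p\<^sub>j\<close>, \<open>q\<^sub>j\<close>, so
  the rows of powers of a class span a left space of dimension two.\<close>

lemma conjugate_powers_dependent:
  assumes "a \<sim>\<^sub>q b" "a \<sim>\<^sub>q c" "u + v + w = 0" "u * a + v * b + w * c = 0"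
  shows "u * a ^ j + v * b ^ j + w * c ^ j = 0"
proof -
  define t s where "t = Quat (2 * qRe a) 0 0 0" and "s = Quat (qnorm2 a) 0 0 0"
  have t: "x * t = t * x" and s: "x * s = s * x" for x by (simp_all add: t_def s_def quat_defs)
  have rec: "u * x ^ Suc (Suc j) = t * (u * x ^ Suc j) - s * (u * x ^ j)"
    if "x \<sim>\<^sub>q a" for u x j
  proof -
    have "x ^ Suc (Suc j) = (x * x) * x ^ j" by (simp add: mult.assoc)
    also have "x * x = t * x - s" using quat_square[of x] that by (simp add: t_def s_def qsim_iff)
    finally have "u * x ^ Suc (Suc j) = u * ((t * x - s) * x ^ j)" by simp
    also have "\<dots> = (u * t) * x ^ Suc j - (u * s) * x ^ j"
      by (simp add: algebra_simps)
    finally have "u * x ^ Suc (Suc j) = (u * t) * x ^ Suc j - (u * s) * x ^ j" .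
    then show ?thesis by (simp only: t s mult.assoc)
  qed
  have abc: "a \<sim>\<^sub>q a" "b \<sim>\<^sub>q a" "c \<sim>\<^sub>q a" using assms by (auto simp: qsim_iff)
  show ?thesis
  proof (induction j rule: induct_nat_012)
    case (ge2 j)
    have "u * a ^ Suc (Suc j) + v * b ^ Suc (Suc j) + w * c ^ Suc (Suc j) =
      t * (u * a ^ Suc j + v * b ^ Suc j + w * c ^ Suc j) - s * (u * a ^ j + v * b ^ j + w * c ^ j)"
      unfolding rec[OF abc(1)] rec[OF abc(2)] rec[OF abc(3)]
      by (simp only: distrib_left) (simp only: algebra_simps)
    then show ?case unfolding ge2 by simp
  qed (use assms in simp_all)
qed

text \<open>For \<open>a \<noteq> b\<close>, set \<open>w = 1\<close> and eliminate
  \<open>u\<close>; what remains is v (b - a) = a - c. The last condition is nontriviality, as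
  \<open>v = w = 0\<close> forces \<open>u = 0\<close>.\<close>

lemma three_rows_dependent:
  fixes a b c :: quat
  obtains u v w where "u + v + w = 0" "u * a + v * b + w * c = 0" "w \<noteq> 0 \<or> v \<noteq> 0"
proof (cases "a = b")
  case True
  then show thesis using that[of "-1" 1 0] by simp
next
  case False
  define v where "v = (a - c) * inverse (b - a)"
  have "v * (b - a) = a - c" using False by (simp add: v_def mult.assoc)
  then show thesis using that[of "- v - 1" v 1] by (simp add: algebra_simps)
qed

theorem corollary4p5:
  fixes n m :: nat and \<alpha> :: "nat \<Rightarrow> quat list"
  assumes "\<And>i. i \<in> {1..n} \<Longrightarrow> spherical_chain (\<alpha> i)"
    and "m = (\<Sum>i = 1..n. length (\<alpha> i))"
  shows "invertible_mat (confluent_vandermonde m (map \<alpha> [1..<Suc n])) \<longleftrightarrow>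
    inj_on (\<lambda>i. hd (\<alpha> i)) {1..n} \<and>
    \<not> (\<exists>i j k. 1 \<le> i \<and> i < j \<and> j < k \<and> k \<le> n \<and>
         hd (\<alpha> i) \<sim>\<^sub>q hd (\<alpha> j) \<and> hd (\<alpha> j) \<sim>\<^sub>q hd (\<alpha> k))"
proof -
  define ass where "ass = map \<alpha> [1..<Suc n]"
  define V where "V = confluent_vandermonde m ass"
  \<comment> \<open>The first row of the block of chain \<open>i\<close>; chains are numbered from
    1, list entries from 0.\<close>
  define pos where "pos i = sum_list (map length (take (i - 1) ass))" for i
  have ne: "\<alpha> i \<noteq> []" if "i \<in> {1..n}" for i
    using assms(1)[OF that] by (auto simp: spherical_chain_def)
  have len: "sum_list (map length ass) = m"
    unfolding assms(2) ass_def map_map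
    by (subst sum_list_distinct_conv_sum_set)
      (simp_all add: atLeastLessThanSuc_atLeastAtMost del: upt_Suc)
  have V: "V \<in> carrier_mat m m"
    using confluent_vandermonde_carrier[of m ass] len by (simp add: V_def)
  have nth: "i - 1 < length ass" "ass ! (i - 1) = \<alpha> i" if "i \<in> {1..n}" for i
    using that by (auto simp: ass_def simp del: upt_Suc)
  have pos_less: "pos i + r < m" if "i \<in> {1..n}" "r < length (\<alpha> i)" for i r
    using sum_list_take_length_less[of "i - 1" ass r] that nth len by (simp add: pos_def)
  have entry: "V $$ (pos i + r, j) = left_divdiff (take (Suc r) (\<alpha> i)) (Z ^ j)"
    if "i \<in> {1..n}" "r < length (\<alpha> i)" "j < m" for i r j
    using confluent_vandermonde_index[of "i - 1" ass r j m] that nth by (simp add: V_def pos_def)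
  have pos0: "pos i < m" if "i \<in> {1..n}" for i
    using pos_less[OF that, of 0] ne[OF that] by simp
  \<comment> \<open>The divided difference at a single node is evaluation, so each block starts with
    the powers of its head.\<close>
  have entry0: "V $$ (pos i, j) = hd (\<alpha> i) ^ j" if "i \<in> {1..n}" "j < m" for i j
    using entry[OF that(1) _ that(2), of 0] ne[OF that(1)]
    by (cases "\<alpha> i") (simp_all add: left_divdiff_def Z_power left_eval_single)
  have pos_mono: "pos i < pos k" if "i \<in> {1..n}" "k \<in> {1..n}" "i < k" for i k
    unfolding pos_def
  proof (rule sum_list_take_strict_mono)
    show "as \<noteq> []" if "as \<in> set ass" for as using that ne by (auto simp: ass_def)
  qed (use that in \<open>auto simp: ass_def simp del: upt_Suc\<close>)
  define no3 where "no3 \<longleftrightarrow> \<not> (\<exists>i j k. 1 \<le> i \<and> i < j \<and> j < k \<and> k \<le> n \<and>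
         hd (\<alpha> i) \<sim>\<^sub>q hd (\<alpha> j) \<and> hd (\<alpha> j) \<sim>\<^sub>q hd (\<alpha> k))"
  have "invertible_mat V \<longleftrightarrow> inj_on (\<lambda>i. hd (\<alpha> i)) {1..n} \<and> no3"
  proof
    assume inv: "invertible_mat V"
    have "hd (\<alpha> i) \<noteq> hd (\<alpha> k)" if "i \<in> {1..n}" "k \<in> {1..n}" "i < k" for i k
    proof
      assume eq: "hd (\<alpha> i) = hd (\<alpha> k)"
      \<comment> \<open>The difference of the first rows of the two blocks, which agree when the
        heads do.\<close>
      define u :: "nat \<Rightarrow> quat" where
        "u p = (if p = pos i then 1 else 0) - (if p = pos k then 1 else 0)" for p
      have "(\<Sum>p<m. u p * V $$ (p, j)) = V $$ (pos i, j) - V $$ (pos k, j)" for j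
        using pos0 that unfolding u_def
        by (simp add: left_diff_distrib sum_subtractf if_distrib[where f = "\<lambda>x. x * _"] cong: if_cong)
      then have "(\<Sum>p<m. u p * V $$ (p, j)) = 0" if "j < m" for j
        using entry0 \<open>i \<in> _\<close> \<open>k \<in> _\<close> that eq by simp
      from invertible_mat_left_null[OF V inv this pos0[OF that(1)]]
      show False using pos_mono[OF that] by (simp add: u_def)
    qed
    then have "inj_on (\<lambda>i. hd (\<alpha> i)) {1..n}" by (intro inj_onI) (metis nat_neq_iff)
    moreover have no3
      unfolding no3_def
    proof clarify
      fix i j k assume ijk: "1 \<le> i" "i < j" "j < k" "k \<le> n"
        "hd (\<alpha> i) \<sim>\<^sub>q hd (\<alpha> j)" "hd (\<alpha> j) \<sim>\<^sub>q hd (\<alpha> k)"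
      then have mem: "i \<in> {1..n}" "j \<in> {1..n}" "k \<in> {1..n}" by auto
      obtain a b c where abc: "a + b + c = 0"
        "a * hd (\<alpha> i) + b * hd (\<alpha> j) + c * hd (\<alpha> k) = 0" "c \<noteq> 0 \<or> b \<noteq> 0"
        by (rule three_rows_dependent)
      define u where "u p = (if p = pos i then a else 0) + (if p = pos j then b else 0) +
        (if p = pos k then c else 0)" for p
      have sum: "(\<Sum>p<m. u p * V $$ (p, l)) =
          a * V $$ (pos i, l) + b * V $$ (pos j, l) + c * V $$ (pos k, l)" for l
        using pos0 mem unfolding u_def
        by (simp add: distrib_right sum.distrib if_distrib[where f = "\<lambda>x. x * _"] cong: if_cong)
      have null: "(\<Sum>p<m. u p * V $$ (p, l)) = 0" if "l < m" for l
        unfolding sum using entry0 mem that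
          conjugate_powers_dependent[OF ijk(5) _ abc(1,2), of l] ijk(5,6) by (simp add: qsim_iff)
      \<comment> \<open>Distinct positions keep \<open>b\<close> and \<open>c\<close> visible as
        values of \<open>u\<close>, so the dependence is nontrivial.\<close>
      have "pos i < pos j" "pos j < pos k" using pos_mono mem ijk by auto
      then have "u (pos j) = b" "u (pos k) = c" by (auto simp: u_def)
      then show False
        using abc(3) invertible_mat_left_null[OF V inv null pos0] mem by metis
    qed
    ultimately show "inj_on (\<lambda>i. hd (\<alpha> i)) {1..n} \<and> no3" ..
  next
    assume rhs: "inj_on (\<lambda>i. hd (\<alpha> i)) {1..n} \<and> no3"
    show "invertible_mat V"
    proof (rule invertible_mat_of_trivial_kernel[OF V])
      fix x assume ker: "\<And>i. i < m \<Longrightarrow> (\<Sum>j<m. V $$ (i, j) * x j) = 0"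
      \<comment> \<open>The kernel vector read as a coefficient sequence, with the entries on the
        right to match left evaluation.\<close>
      define f where "f = (\<Sum>j<m. Z ^ j * qconst (x j))"
      have f_lookup: "Poly_Mapping.lookup f l = (if l < m then x l else 0)" for l
        unfolding f_def by (simp add: Z_power qconst_def mult_single lookup_sum lookup_single when_def)
      have "f = 0"
      proof (rule lin_factors_system_eq_0[of "{1..n}" \<alpha>])
        show "lin_factors (\<alpha> i) f" if i: "i \<in> {1..n}" for i
        proof (rule lin_factors_of_left_divdiff)
          fix r assume r: "r < length (\<alpha> i)"
          have "left_divdiff (take (Suc r) (\<alpha> i)) f =
              (\<Sum>j<m. left_divdiff (take (Suc r) (\<alpha> i)) (Z ^ j) * x j)"
            unfolding f_def by (rule left_divdiff_sum) simp
          also have "\<dots> = (\<Sum>j<m. V $$ (pos i + r, j) * x j)"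
            using entry[OF i r] by (intro sum.cong) auto
          also have "\<dots> = 0" by (rule ker[OF pos_less[OF i r]])
          finally show "left_divdiff (take (Suc r) (\<alpha> i)) f = 0" .
        qed
        show "\<not> hd (\<alpha> i) \<sim>\<^sub>q hd (\<alpha> k)"
          if ijk: "i \<in> {1..n}" "j \<in> {1..n}" "k \<in> {1..n}" "i \<noteq> j" "i \<noteq> k" "j \<noteq> k"
            "hd (\<alpha> i) \<sim>\<^sub>q hd (\<alpha> j)" for i j k
        proof
          assume "hd (\<alpha> i) \<sim>\<^sub>q hd (\<alpha> k)"
          then have all: "x \<in> {i, j, k} \<Longrightarrow> y \<in> {i, j, k} \<Longrightarrow> hd (\<alpha> x) \<sim>\<^sub>q hd (\<alpha> y)" for x y
            using ijk(7) by (auto simp: qsim_iff)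
          \<comment> \<open>\<open>no3\<close> speaks of increasing triples, the goal of distinct
            ones; one of the six orderings is increasing.\<close>
          have no: "\<not> (x < y \<and> y < z)" if "x \<in> {i, j, k}" "y \<in> {i, j, k}" "z \<in> {i, j, k}" for x y z
          proof
            assume "x < y \<and> y < z"
            moreover have "1 \<le> x" "z \<le> n" using that ijk by auto
            ultimately show False using rhs all[OF that(1,2)] all[OF that(2,3)] no3_def by blast
          qed
          show False
            using no[of i j k] no[of i k j] no[of j i k] no[of j k i] no[of k i j] no[of k j i] ijk(4-6)
            by auto
        qed
        show "Poly_Mapping.lookup f j = 0" if "j \<ge> (\<Sum>i\<in>{1..n}. length (\<alpha> i))" for j
          using that assms(2) f_lookup by simp
      qed (use assms(1) rhs in auto)
      then show "\<forall>j<m. x j = 0" using f_lookup by (metis lookup_zero)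
    qed
  qed
  then show ?thesis unfolding V_def ass_def no3_def .
qed

end
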